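(* If $X$ and $Y$ are quasisober spaces (respectively cut spaces, weakly sober spaces), then the set $Top(X,Y)$ of all continuous functions $f:X\to Y$, equipped with the topology of pointwise convergence, is not always quasisober (respectively a cut space, weakly sober). That is: (i) there exist quasisober spaces $X,Y$ such that $Top(X,Y)$ is not quasisober; (ii) there exist cut spaces $X,Y$ such that $Top(X,Y)$ is not a cut space; (iii) there exist weakly sober spaces $X,Y$ such that $Top(X,Y)$ is not weakly sober.
   Context: For a topological space $X$, the specialization preorder is $x\le y$ iff $x\in\mathrm{cl}\{y\}$; all order-theoretic notions in $X$ refer to it. For $A\subseteq X$, $A^{\uparrow}$ and $A^{\downarrow}$ denote the sets of all upper, respectively lower, bounds of $A$ in $X$, and $A^{\delta}=(A^{\uparrow})^{\downarrow}$ is the cut closure of $A$; $A$ is a cut if $A=A^{\delta}$. Directed sets and irreducible closed sets are nonempty. $X$ is a cut space if $\mathrm{cl}\,D=D^{\delta}$ for every directed subset $D$ of $X$. $X$ is weakly sober if it is $T_0$ and every irreducible closed subset $A$ of $X$ is a cut. $X$ is quasisober if it is $T_0$ and every irreducible closed subset of $X$ equals $D^{\delta}$ for some directed subset $D$ of $X$. The topology of pointwise convergence on $Top(X,Y)$ has as subbasis the sets $S(x,U)=\{f\in Top(X,Y): f(x)\in U\}$ with $x\in X$ and $U$ open in $Y$. *)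

theory Defs
  imports "HOL-Analysis.Analysis"
begin

definition spec_le :: "'a topology \<Rightarrow> 'a \<Rightarrow> 'a \<Rightarrow> bool" where
  "spec_le X x y \<longleftrightarrow> x \<in> topspace X \<and> y \<in> topspace X \<and> x \<in> X closure_of {y}"

definition upper_bounds :: "'a topology \<Rightarrow> 'a set \<Rightarrow> 'a set" where
  "upper_bounds X A = {u \<in> topspace X. \<forall>a\<in>A. spec_le X a u}"

definition lower_bounds :: "'a topology \<Rightarrow> 'a set \<Rightarrow> 'a set" where
  "lower_bounds X A = {l \<in> topspace X. \<forall>a\<in>A. spec_le X l a}"

definition cut_closure :: "'a topology \<Rightarrow> 'a set \<Rightarrow> 'a set" where
  "cut_closure X A = lower_bounds X (upper_bounds X A)"

definition is_cut :: "'a topology \<Rightarrow> 'a set \<Rightarrow> bool" where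
  "is_cut X A \<longleftrightarrow> A \<subseteq> topspace X \<and> A = cut_closure X A"

definition directed_in :: "'a topology \<Rightarrow> 'a set \<Rightarrow> bool" where
  "directed_in X D \<longleftrightarrow> D \<subseteq> topspace X \<and> D \<noteq> {} \<and>
     (\<forall>x\<in>D. \<forall>y\<in>D. \<exists>z\<in>D. spec_le X x z \<and> spec_le X y z)"

definition irreducible_closedin :: "'a topology \<Rightarrow> 'a set \<Rightarrow> bool" where
  "irreducible_closedin X A \<longleftrightarrow> closedin X A \<and> A \<noteq> {} \<and>
     (\<forall>B C. closedin X B \<and> closedin X C \<and> A = B \<union> C \<longrightarrow> A = B \<or> A = C)"

definition cut_space :: "'a topology \<Rightarrow> bool" where
  "cut_space X \<longleftrightarrow> (\<forall>D. directed_in X D \<longrightarrow> X closure_of D = cut_closure X D)"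

definition weakly_sober :: "'a topology \<Rightarrow> bool" where
  "weakly_sober X \<longleftrightarrow> t0_space X \<and> (\<forall>A. irreducible_closedin X A \<longrightarrow> is_cut X A)"

definition quasisober :: "'a topology \<Rightarrow> bool" where
  "quasisober X \<longleftrightarrow> t0_space X \<and>
     (\<forall>A. irreducible_closedin X A \<longrightarrow> (\<exists>D. directed_in X D \<and> A = cut_closure X D))"

text \<open>
  Since spaces carry an explicit underlying set, a function on a space is represented by its
  extensional representative, with value \<^const>\<open>undefined\<close> outside the domain.
\<close>

definition Top :: "'a topology \<Rightarrow> 'b topology \<Rightarrow> ('a \<Rightarrow> 'b) set" where
  "Top X Y = {f \<in> extensional (topspace X). continuous_map X Y f}"

text \<open>
  The clause \<open>relative_to\<close> below makes the empty intersection of subbasic sets the whole of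
  \<open>Top X Y\<close>. With \<^const>\<open>topology_generated_by\<close> the underlying set would be wrong for empty \<open>X\<close>,
  where there are no subbasic sets.
\<close>

definition pointwise_topology :: "'a topology \<Rightarrow> 'b topology \<Rightarrow> ('a \<Rightarrow> 'b) topology" where
  "pointwise_topology X Y =
     topology (arbitrary union_of
       (finite intersection_of
          (\<lambda>S. \<exists>x U. x \<in> topspace X \<and> openin Y U \<and> S = {f \<in> Top X Y. f x \<in> U})
        relative_to Top X Y))"

lemma topspace_pointwise_topology [simp]: "topspace (pointwise_topology X Y) = Top X Y"
  by (simp add: pointwise_topology_def)

end

theory Submission
  imports Defs
begin

text \<open>
  Quasisober spaces are weakly sober and weakly sober spaces are cut spaces, so a single pair of
  quasisober spaces whose function space is not a cut space suffices. Let \<open>Y\<close> be an ascending chain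
  \<open>2 < 3 < \<dots>\<close> below two incomparable maximal elements \<open>0\<close> and \<open>1\<close>, and \<open>X\<close> the chain of natural
  numbers, both with the topology of upper sets; continuity then means monotonicity. The functions
  with value \<open>n + 2\<close> at \<open>0\<close> and value \<open>1\<close> elsewhere form a directed set \<open>D\<close>. At the point \<open>0\<close>, both
  \<open>0\<close> and \<open>1\<close> bound their values, but monotonicity leaves the constant function \<open>1\<close> as the only upper
  bound. It therefore lies in the cut closure of \<open>D\<close>, but not in the closure, as \<open>{1}\<close> is open in \<open>Y\<close>.
\<close>

section \<open>Cut closures, and the implications between the three properties\<close>

lemma closedin_spec_le_downward:
  assumes "closedin X B" "spec_le X x y" "y \<in> B"
  shows "x \<in> B"
  using assms closure_of_minimal[of "{y}" B X] by (auto simp: spec_le_def)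

lemma spec_le_refl: "x \<in> topspace X \<Longrightarrow> spec_le X x x"
  by (simp add: spec_le_def in_closure_of)

lemma spec_le_iff_open:
  "spec_le X x y \<longleftrightarrow>
     x \<in> topspace X \<and> y \<in> topspace X \<and> (\<forall>U. openin X U \<and> x \<in> U \<longrightarrow> y \<in> U)"
  by (auto simp: spec_le_def in_closure_of)

text \<open>For every upper bound \<open>u\<close> of \<open>D\<close>, the closure of
  \<open>{u}\<close> is a closed set containing \<open>D\<close>, hence containing the closure of
  \<open>D\<close>.\<close>

lemma closure_of_subset_cut_closure:
  assumes "D \<subseteq> topspace X"
  shows "X closure_of D \<subseteq> cut_closure X D"
proof
  fix x assume x: "x \<in> X closure_of D"
  have xX: "x \<in> topspace X"
    using x by (simp add: in_closure_of)
  have "spec_le X x u" if "u \<in> upper_bounds X D" for u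
  proof -
    have "D \<subseteq> X closure_of {u}" "u \<in> topspace X"
      using that by (auto simp: upper_bounds_def spec_le_def)
    then have "x \<in> X closure_of {u}"
      using x closure_of_minimal[of D "X closure_of {u}" X] by auto
    with xX \<open>u \<in> topspace X\<close> show ?thesis
      by (simp add: spec_le_def)
  qed
  with xX show "x \<in> cut_closure X D"
    by (simp add: cut_closure_def lower_bounds_def)
qed

lemma cut_closure_mono: "A \<subseteq> B \<Longrightarrow> cut_closure X A \<subseteq> cut_closure X B"
  by (auto simp: cut_closure_def lower_bounds_def upper_bounds_def)

text \<open>Upper and lower bounds form a Galois connection, so \<open>A\<close> and its cut closure
  have the same upper bounds.\<close>

lemma is_cut_cut_closure: "is_cut X (cut_closure X A)"
proof -
  have "upper_bounds X A \<subseteq> upper_bounds X (cut_closure X A)"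
    by (auto simp: cut_closure_def lower_bounds_def upper_bounds_def)
  moreover have "cut_closure X A \<subseteq> cut_closure X (cut_closure X A)"
    by (auto simp: cut_closure_def lower_bounds_def upper_bounds_def)
  ultimately show ?thesis
    by (auto simp: is_cut_def cut_closure_def lower_bounds_def)
qed

text \<open>If closed sets \<open>B\<close> and \<open>C\<close> cover the closure, then
  \<open>D\<close> lies inside one of them: a point of \<open>D\<close> above a point outside
  \<open>B\<close> and a point outside \<open>C\<close> would avoid both, closed sets being lower
  sets.\<close>

lemma irreducible_closedin_closure_of_directed:
  assumes "directed_in X D"
  shows "irreducible_closedin X (X closure_of D)"
proof -
  have DX: "D \<subseteq> topspace X" and ne: "D \<noteq> {}"
    and ub: "\<And>x y. x \<in> D \<Longrightarrow> y \<in> D \<Longrightarrow> \<exists>z\<in>D. spec_le X x z \<and> spec_le X y z"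
    using assms by (auto simp: directed_in_def)
  have sub: "D \<subseteq> X closure_of D"
    by (rule closure_of_subset[OF DX])
  have "X closure_of D = B \<or> X closure_of D = C"
    if B: "closedin X B" and C: "closedin X C" and eq: "X closure_of D = B \<union> C" for B C
  proof -
    have "D \<subseteq> B \<or> D \<subseteq> C"
    proof (rule ccontr)
      assume "\<not> (D \<subseteq> B \<or> D \<subseteq> C)"
      then obtain x y where "x \<in> D" "x \<notin> B" "y \<in> D" "y \<notin> C"
        by blast
      moreover obtain z where "z \<in> D" "spec_le X x z" "spec_le X y z"
        using ub \<open>x \<in> D\<close> \<open>y \<in> D\<close> by blast
      ultimately show False
        using closedin_spec_le_downward[OF B] closedin_spec_le_downward[OF C] sub eq by blast
    qed
    then show ?thesis
      using closure_of_minimal[OF _ B] closure_of_minimal[OF _ C] eq by blast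
  qed
  then show ?thesis
    using ne sub by (auto simp: irreducible_closedin_def)
qed

lemma quasisober_imp_weakly_sober: "quasisober X \<Longrightarrow> weakly_sober X"
  unfolding quasisober_def weakly_sober_def using is_cut_cut_closure by metis

text \<open>The closure of a directed set is irreducible, hence a cut; a cut containing
  \<open>D\<close> contains the cut closure of \<open>D\<close>.\<close>

lemma weakly_sober_imp_cut_space:
  assumes "weakly_sober X"
  shows "cut_space X"
  unfolding cut_space_def
proof (intro allI impI)
  fix D assume D: "directed_in X D"
  then have DX: "D \<subseteq> topspace X"
    by (simp add: directed_in_def)
  have "X closure_of D = cut_closure X (X closure_of D)"
    using assms irreducible_closedin_closure_of_directed[OF D]
    by (simp add: weakly_sober_def is_cut_def)
  then have "cut_closure X D \<subseteq> X closure_of D"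
    using cut_closure_mono[OF closure_of_subset[OF DX]] by blast
  then show "X closure_of D = cut_closure X D"
    using closure_of_subset_cut_closure[OF DX] by blast
qed

section \<open>Upper-set topologies and the pointwise order\<close>

text \<open>For a preorder \<open>r\<close> this is the Alexandrov topology. The sets stable under
  an arbitrary relation also form a topology, which permits a relation consisting of a single pair
  in the study of the pointwise order.\<close>

definition upper_set_topology :: "('a \<Rightarrow> 'a \<Rightarrow> bool) \<Rightarrow> 'a topology" where
  "upper_set_topology r = topology (\<lambda>U. \<forall>x\<in>U. \<forall>y. r x y \<longrightarrow> y \<in> U)"

lemma openin_upper_set_topology:
  "openin (upper_set_topology r) U \<longleftrightarrow> (\<forall>x\<in>U. \<forall>y. r x y \<longrightarrow> y \<in> U)"
proof -
  have "istopology (\<lambda>U. \<forall>x\<in>U. \<forall>y. r x y \<longrightarrow> y \<in> U)"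
    unfolding istopology_def by blast
  then show ?thesis
    by (simp add: upper_set_topology_def topology_inverse')
qed

lemma openin_pointwise_topology_subbasic:
  assumes "x \<in> topspace X" "openin Y U"
  shows "openin (pointwise_topology X Y) {f \<in> Top X Y. f x \<in> U}"
  unfolding pointwise_topology_def openin_subbase
proof (rule arbitrary_union_of_inc)
  let ?P = "\<lambda>S. \<exists>x U. x \<in> topspace X \<and> openin Y U \<and> S = {f \<in> Top X Y. f x \<in> U}"
  have "(finite intersection_of ?P) {f \<in> Top X Y. f x \<in> U}"
    by (rule finite_intersection_of_inc) (use assms in blast)
  then have "(finite intersection_of ?P relative_to Top X Y)
      (Top X Y \<inter> {f \<in> Top X Y. f x \<in> U})"
    by (rule relative_to_inc)
  then show "(finite intersection_of ?P relative_to Top X Y) {f \<in> Top X Y. f x \<in> U}"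
    by (simp add: Int_absorb1 subset_iff)
qed

text \<open>Subbasic sets detect the order at each point. Conversely, the open sets that contain
  \<open>g\<close> whenever they contain \<open>f\<close> are closed under unions and finite
  intersections, so it suffices to check the subbasis.\<close>

lemma spec_le_pointwise_topology:
  "spec_le (pointwise_topology X Y) f g \<longleftrightarrow>
     f \<in> Top X Y \<and> g \<in> Top X Y \<and> (\<forall>x\<in>topspace X. spec_le Y (f x) (g x))"
proof (intro iffI conjI ballI)
  assume le: "spec_le (pointwise_topology X Y) f g"
  then show f: "f \<in> Top X Y" and g: "g \<in> Top X Y"
    by (auto simp: spec_le_def)
  fix x assume x: "x \<in> topspace X"
  have "f x \<in> topspace Y" "g x \<in> topspace Y"
    using f g x by (auto simp: Top_def continuous_map_def)
  moreover have "g x \<in> U" if "openin Y U" "f x \<in> U" for U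
    using le f openin_pointwise_topology_subbasic[OF x \<open>openin Y U\<close>] that
    by (auto simp: spec_le_iff_open)
  ultimately show "spec_le Y (f x) (g x)"
    by (auto simp: spec_le_iff_open)
next
  assume *: "f \<in> Top X Y \<and> g \<in> Top X Y \<and> (\<forall>x\<in>topspace X. spec_le Y (f x) (g x))"
  \<comment> \<open>the finest topology in which every open set containing \<open>f\<close> contains \<open>g\<close>\<close>
  let ?T = "upper_set_topology (\<lambda>a b. a = f \<and> b = g)"
  have "openin ?T U" if "openin (pointwise_topology X Y) U" for U
    using _ _ that[unfolded pointwise_topology_def]
  proof (rule minimal_topology_subbase)
    show "openin ?T (Top X Y)"
      using * by (simp add: openin_upper_set_topology)
    fix S assume "\<exists>x U. x \<in> topspace X \<and> openin Y U \<and> S = {f \<in> Top X Y. f x \<in> U}"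
    then obtain x U where "x \<in> topspace X" "openin Y U" "S = {f \<in> Top X Y. f x \<in> U}"
      by blast
    with * show "openin ?T S"
      by (simp add: openin_upper_set_topology spec_le_iff_open)
  qed
  with * show "spec_le (pointwise_topology X Y) f g"
    by (simp add: spec_le_iff_open openin_upper_set_topology)
qed

lemma topspace_upper_set_topology [simp]: "topspace (upper_set_topology r) = UNIV"
  using openin_subset[of "upper_set_topology r" UNIV] by (simp add: openin_upper_set_topology top.extremum_unique)

lemma closedin_upper_set_topology:
  "closedin (upper_set_topology r) A \<longleftrightarrow> (\<forall>y\<in>A. \<forall>x. r x y \<longrightarrow> x \<in> A)"
  by (auto simp: closedin_def openin_upper_set_topology)

text \<open>The principal upper set of \<open>x\<close> is open by transitivity and contains
  \<open>x\<close> by reflexivity, so it is the least open neighbourhood of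
  \<open>x\<close>.\<close>

lemma spec_le_upper_set_topology:
  assumes "reflp r" "transp r"
  shows "spec_le (upper_set_topology r) = r"
proof (intro ext iffI)
  fix x y
  assume "spec_le (upper_set_topology r) x y"
  moreover have "openin (upper_set_topology r) {z. r x z}"
    using transpD[OF assms(2)] unfolding openin_upper_set_topology by blast
  ultimately show "r x y"
    using reflpD[OF assms(1)] unfolding spec_le_iff_open by blast
next
  fix x y
  assume "r x y"
  then show "spec_le (upper_set_topology r) x y"
    by (auto simp: spec_le_iff_open openin_upper_set_topology)
qed

text \<open>If \<open>x\<close> and \<open>y\<close> had no common upper bound in \<open>A\<close>,
  then \<open>A\<close> would be the union of its points not above \<open>x\<close> and its points
  not above \<open>y\<close>. Both sets are closed, and they omit \<open>x\<close> and
  \<open>y\<close> respectively.\<close>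

lemma directed_in_irreducible_upper_set_topology:
  assumes r: "reflp r" "transp r" and A: "irreducible_closedin (upper_set_topology r) A"
  shows "directed_in (upper_set_topology r) A"
proof -
  have low: "\<And>x y. y \<in> A \<Longrightarrow> r x y \<Longrightarrow> x \<in> A" and ne: "A \<noteq> {}"
    and irr: "\<And>B C. closedin (upper_set_topology r) B \<Longrightarrow> closedin (upper_set_topology r) C \<Longrightarrow>
        A = B \<union> C \<Longrightarrow> A = B \<or> A = C"
    using A by (auto simp: irreducible_closedin_def closedin_upper_set_topology)
  have "\<exists>z\<in>A. r x z \<and> r y z" if "x \<in> A" "y \<in> A" for x y
  proof (rule ccontr)
    assume no: "\<not> (\<exists>z\<in>A. r x z \<and> r y z)"
    have "closedin (upper_set_topology r) {z \<in> A. \<not> r w z}" for w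
      using low transpD[OF r(2)] unfolding closedin_upper_set_topology by blast
    moreover have "A = {z \<in> A. \<not> r x z} \<union> {z \<in> A. \<not> r y z}"
      using no by blast
    ultimately have "A = {z \<in> A. \<not> r x z} \<or> A = {z \<in> A. \<not> r y z}"
      using irr by blast
    then show False
      using that reflpD[OF r(1)] by blast
  qed
  then show ?thesis
    using ne by (auto simp: directed_in_def spec_le_upper_set_topology[OF r])
qed

text \<open>The assumption \<open>cut\<close> makes every nonempty lower set a cut. An irreducible
  closed set is a directed lower set, so it can itself serve as \<open>D\<close>.\<close>

lemma quasisober_upper_set_topology:
  assumes r: "reflp r" "transp r" and "antisymp r"
    and cut: "\<And>A x. A \<noteq> {} \<Longrightarrow> (\<And>y z. y \<in> A \<Longrightarrow> r z y \<Longrightarrow> z \<in> A) \<Longrightarrow> x \<notin> A \<Longrightarrow>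
        \<exists>u. (\<forall>a\<in>A. r a u) \<and> \<not> r x u"
  shows "quasisober (upper_set_topology r)"
proof -
  have "t0_space (upper_set_topology r)"
  proof -
    have "\<exists>U. openin (upper_set_topology r) U \<and> (x \<notin> U \<longleftrightarrow> y \<in> U)" if "x \<noteq> y" for x y
    proof -
      have "\<not> r x y \<or> \<not> r y x"
        using that antisympD[OF \<open>antisymp r\<close>] by blast
      moreover have "openin (upper_set_topology r) {z. r w z}" "r w w" for w
        using transpD[OF r(2)] reflpD[OF r(1)] unfolding openin_upper_set_topology by blast+
      ultimately show ?thesis
        by (metis mem_Collect_eq)
    qed
    then show ?thesis
      by (auto simp: t0_space_def)
  qed
  moreover have "\<exists>D. directed_in (upper_set_topology r) D \<and> A = cut_closure (upper_set_topology r) D"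
    if A: "irreducible_closedin (upper_set_topology r) A" for A
  proof (intro exI conjI)
    show "directed_in (upper_set_topology r) A"
      by (rule directed_in_irreducible_upper_set_topology[OF r A])
    have "A \<noteq> {}" "\<And>y z. y \<in> A \<Longrightarrow> r z y \<Longrightarrow> z \<in> A"
      using A by (auto simp: irreducible_closedin_def closedin_upper_set_topology)
    then have "A = {x. \<forall>u. (\<forall>a\<in>A. r a u) \<longrightarrow> r x u}"
      using cut[of A] by blast
    then show "A = cut_closure (upper_set_topology r) A"
      by (simp add: cut_closure_def lower_bounds_def upper_bounds_def
          spec_le_upper_set_topology[OF r])
  qed
  ultimately show ?thesis
    by (simp add: quasisober_def)
qed

section \<open>The two quasisober spaces\<close>

lemma quasisober_nat_le: "quasisober (upper_set_topology ((\<le>) :: nat \<Rightarrow> nat \<Rightarrow> bool))"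
proof (rule quasisober_upper_set_topology)
  fix A :: "nat set" and x
  assume A: "A \<noteq> {}" "\<And>y z. y \<in> A \<Longrightarrow> z \<le> y \<Longrightarrow> z \<in> A" "x \<notin> A"
  have less: "a < x" if "a \<in> A" for a
    using A(2,3) that not_le by blast
  moreover have "x \<noteq> 0"
    using less A(1) by auto
  ultimately show "\<exists>u. (\<forall>a\<in>A. a \<le> u) \<and> \<not> x \<le> u"
    by (intro exI[of _ "x - 1"]) fastforce
qed (auto simp: antisymp_def)

definition forked_le :: "nat \<Rightarrow> nat \<Rightarrow> bool" where
  "forked_le x y \<longleftrightarrow> x = y \<or> 2 \<le> x \<and> (y < 2 \<or> x \<le> y)"

lemma reflp_forked_le: "reflp forked_le" and transp_forked_le: "transp forked_le"
  and antisymp_forked_le: "antisymp forked_le"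
  by (auto simp: reflp_def transp_def antisymp_def forked_le_def)

lemma quasisober_forked_le: "quasisober (upper_set_topology forked_le)"
proof (rule quasisober_upper_set_topology[OF reflp_forked_le transp_forked_le antisymp_forked_le])
  fix A :: "nat set" and x
  assume A: "A \<noteq> {}" "\<And>y z. y \<in> A \<Longrightarrow> forked_le z y \<Longrightarrow> z \<in> A" "x \<notin> A"
  show "\<exists>u. (\<forall>a\<in>A. forked_le a u) \<and> \<not> forked_le x u"
  proof (cases "x < 2")
    case True
    \<comment> \<open>\<open>1 - x\<close> is the other maximal point: it bounds every set that
      omits \<open>x\<close>.\<close>
    then have "forked_le a (1 - x)" if "a \<in> A" for a
      using that A(3) by (cases "a < 2") (auto simp: forked_le_def less_2_cases_iff)
    moreover have "\<not> forked_le x (1 - x)"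
      using True by (auto simp: forked_le_def less_2_cases_iff)
    ultimately show ?thesis
      by blast
  next
    case False
    \<comment> \<open>Both maximal points lie above the chain element \<open>x\<close>, so a lower
      set omitting \<open>x\<close> contains neither of them.\<close>
    have *: "2 \<le> a \<and> a < x" if "a \<in> A" for a
    proof -
      have "\<not> forked_le x a"
        using A(2,3) that by blast
      with False show ?thesis
        by (auto simp: forked_le_def)
    qed
    \<comment> \<open>Strictness keeps the bound \<open>x - 1\<close> in the chain; for
      \<open>x = 2\<close> it would be the maximal point \<open>1\<close>.\<close>
    with A(1) have "2 < x"
      by fastforce
    with * show ?thesis
      by (intro exI[of _ "x - 1"]) (fastforce simp: forked_le_def)
  qed
qed

section \<open>The function space and its failure to be a cut space\<close>

text \<open>The preimage of the principal upper set of \<open>f x\<close> is open and contains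
  \<open>x\<close>, which forces monotonicity. Extensionality is vacuous because the domain is the
  whole type.\<close>

lemma Top_upper_set_topology:
  assumes "reflp r" "transp r" "reflp s" "transp s"
  shows "Top (upper_set_topology r) (upper_set_topology s) = {f. \<forall>x y. r x y \<longrightarrow> s (f x) (f y)}"
proof -
  have "s (f x) (f y)" if "continuous_map (upper_set_topology r) (upper_set_topology s) f" "r x y"
    for f x y
  proof -
    have "openin (upper_set_topology s) {z. s (f x) z}"
      using transpD[OF assms(4)] unfolding openin_upper_set_topology by blast
    then have "openin (upper_set_topology r) {w. s (f x) (f w)}"
      using openin_continuous_map_preimage[OF that(1)] by force
    then show ?thesis
      using that(2) reflpD[OF assms(3)] unfolding openin_upper_set_topology by blast
  qed
  moreover have "continuous_map (upper_set_topology r) (upper_set_topology s) f"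
    if "\<forall>x y. r x y \<longrightarrow> s (f x) (f y)" for f
    unfolding continuous_map_def topspace_upper_set_topology openin_upper_set_topology
    using that by blast
  ultimately show ?thesis
    by (auto simp: Top_def)
qed

lemma not_cut_space_pointwise_topology:
  defines "X \<equiv> upper_set_topology ((\<le>) :: nat \<Rightarrow> nat \<Rightarrow> bool)"
    and "Y \<equiv> upper_set_topology forked_le"
  shows "\<not> cut_space (pointwise_topology X Y)"
proof
  assume cut: "cut_space (pointwise_topology X Y)"
  \<comment> \<open>The shift by \<open>2\<close> starts the chain at its bottom element; each
    \<open>F n\<close> is monotone since \<open>1\<close> lies above the whole chain.\<close>
  define F :: "nat \<Rightarrow> nat \<Rightarrow> nat" where "F n x = (if x = 0 then n + 2 else 1)" for n x
  define D where "D = range F"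
  have Top: "Top X Y = {f. \<forall>x y. x \<le> y \<longrightarrow> forked_le (f x) (f y)}"
    unfolding X_def Y_def by (rule Top_upper_set_topology) (auto simp: reflp_forked_le transp_forked_le)
  have le: "spec_le (pointwise_topology X Y) f g \<longleftrightarrow>
      f \<in> Top X Y \<and> g \<in> Top X Y \<and> (\<forall>x. forked_le (f x) (g x))" for f g
    by (simp add: spec_le_pointwise_topology)
       (simp add: X_def Y_def spec_le_upper_set_topology reflp_forked_le transp_forked_le)
  have F: "F n \<in> Top X Y" for n
    by (auto simp: Top F_def forked_le_def)
  have one: "(\<lambda>_. 1) \<in> Top X Y"
    by (auto simp: Top forked_le_def)
  have "directed_in (pointwise_topology X Y) D"
    unfolding directed_in_def
  proof (intro conjI ballI)
    fix f g assume "f \<in> D" "g \<in> D"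
    then obtain m n where "f = F m" "g = F n"
      by (auto simp: D_def)
    then have "spec_le (pointwise_topology X Y) f (F (max m n))"
        "spec_le (pointwise_topology X Y) g (F (max m n))"
      by (auto simp: le F) (auto simp: F_def forked_le_def)
    then show "\<exists>h\<in>D. spec_le (pointwise_topology X Y) f h \<and> spec_le (pointwise_topology X Y) g h"
      by (auto simp: D_def)
  qed (use F in \<open>auto simp: D_def\<close>)
  with cut have eq: "(pointwise_topology X Y) closure_of D = cut_closure (pointwise_topology X Y) D"
    by (simp add: cut_space_def)
  have "g = (\<lambda>_. 1)" if "g \<in> upper_bounds (pointwise_topology X Y) D" for g
  proof -
    have mono: "\<And>x y. x \<le> y \<Longrightarrow> forked_le (g x) (g y)" and ub: "\<And>n x. forked_le (F n x) (g x)"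
      using that by (auto simp: upper_bounds_def D_def le Top)
    \<comment> \<open>Already \<open>F 0\<close> has the maximal value \<open>1\<close> at
      \<open>x\<close>.\<close>
    have g1: "g x = 1" if "x \<noteq> 0" for x
      using ub[of 0 x] that by (simp add: F_def forked_le_def)
    \<comment> \<open>No chain element bounds the chain: with \<open>n = g 0\<close>, a value
      \<open>g 0\<close> in the chain would have to be at least \<open>g 0 + 2\<close>.\<close>
    have "g 0 < 2"
      using ub[of "g 0" 0] by (simp add: F_def forked_le_def)
    \<comment> \<open>This excludes \<open>g 0 = 0\<close>, since \<open>0\<close> and
      \<open>1\<close> are incomparable.\<close>
    moreover have "forked_le (g 0) 1"
      using mono[of 0 1] g1[of 1] by simp
    ultimately have "g 0 = 1"
      by (auto simp: forked_le_def)
    with g1 show ?thesis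
      by (metis ext)
  qed
  then have "(\<lambda>_. 1) \<in> cut_closure (pointwise_topology X Y) D"
    using one spec_le_refl[of "\<lambda>_. 1" "pointwise_topology X Y"]
    by (auto simp: cut_closure_def lower_bounds_def)
  moreover have "(\<lambda>_. 1) \<notin> (pointwise_topology X Y) closure_of D"
  proof -
    have "openin Y {1}"
      by (auto simp: Y_def openin_upper_set_topology forked_le_def)
    \<comment> \<open>Evaluation at \<open>0\<close> separates the constant function from
      \<open>D\<close>, as \<open>n + 2\<close> is never \<open>1\<close>.\<close>
    then have "openin (pointwise_topology X Y) {f \<in> Top X Y. f 0 \<in> {1}}"
      by (intro openin_pointwise_topology_subbasic) (simp_all add: X_def)
    moreover have "{f \<in> Top X Y. f 0 \<in> {1}} \<inter> D = {}"
      by (auto simp: D_def F_def)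
    ultimately have "{f \<in> Top X Y. f 0 \<in> {1}} \<inter> (pointwise_topology X Y) closure_of D = {}"
      by (simp add: openin_Int_closure_of_eq_empty)
    with one show ?thesis
      by auto
  qed
  ultimately show False
    by (simp add: eq)
qed

theorem mainTheorem12:
  shows "(\<exists>(X :: nat topology) (Y :: nat topology).
            quasisober X \<and> quasisober Y \<and> \<not> quasisober (pointwise_topology X Y)) \<and>
         (\<exists>(X :: nat topology) (Y :: nat topology).
            cut_space X \<and> cut_space Y \<and> \<not> cut_space (pointwise_topology X Y)) \<and>
         (\<exists>(X :: nat topology) (Y :: nat topology).
            weakly_sober X \<and> weakly_sober Y \<and> \<not> weakly_sober (pointwise_topology X Y))"
proof -
  let ?X = "upper_set_topology ((\<le>) :: nat \<Rightarrow> nat \<Rightarrow> bool)"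
  let ?Y = "upper_set_topology forked_le"
  have "weakly_sober ?X" "weakly_sober ?Y"
    by (intro quasisober_imp_weakly_sober quasisober_nat_le quasisober_forked_le)+
  moreover have "cut_space ?X" "cut_space ?Y"
    by (intro weakly_sober_imp_cut_space calculation)+
  \<comment> \<open>Being a cut space is the weakest of the three properties, so its failure carries
    over to the other two by contraposition.\<close>
  moreover have "\<not> weakly_sober (pointwise_topology ?X ?Y)"
    using weakly_sober_imp_cut_space not_cut_space_pointwise_topology by (rule contrapos_nn[rotated])
  moreover have "\<not> quasisober (pointwise_topology ?X ?Y)"
    using quasisober_imp_weakly_sober calculation(5) by (rule contrapos_nn[rotated])
  ultimately show ?thesis
    using quasisober_nat_le quasisober_forked_le not_cut_space_pointwise_topology
    by (intro conjI exI) assumption+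
qed

end
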